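(* Let $K$ be a field and let $f_1,\dots,f_n\in K[t_1,\dots,t_s]$ be such that the ideal $\mathrm{Implicit}(f_1,\dots,f_n)\subseteq K[x_1,\dots,x_n]$ is principal and non-zero. Then the algorithm Direct (described in the context), applied to $f_1,\dots,f_n$, terminates, and its output $g_{\mathrm{calc}}\in K[x_1,\dots,x_n]$ generates $\mathrm{Implicit}(f_1,\dots,f_n)$.
   Context: Let $\phi:K[x_1,\dots,x_n]\to K[t_1,\dots,t_s]$ be the $K$-algebra homomorphism sending $x_i\mapsto f_i$, and $\mathrm{Implicit}(f_1,\dots,f_n)=\ker\phi$. A power-product is a monomial with coefficient $1$. An enumerative ordering is a total ordering such that for every element there are only finitely many elements smaller than it; an enumerative term-ordering is a term-ordering (on power-products) which is also enumerative. Algorithm Direct (variables: $QB$, the list of power-products of $K[x_1,\dots,x_n]$ already considered; $PPL$, a list of power-products yet to be considered; $PhiQB$, the list of the images $\phi(T_i)$ for $T_i\in QB$, viewed as vectors in the $K$-vector space $K[t_1,\dots,t_s]$): Step 1 (initialization). Fix an enumerative term-ordering $\sigma$ on the power-products of $K[x_1,\dots,x_n]$. Set $QB=\emptyset$, $PhiQB=\emptyset$, $PPL=\{1\}$. Step 2 (main loop). Repeat: (2.1) Let $T=\min_\sigma(PPL)$ and remove $T$ from $PPL$. (2.2) Compute $v=\phi(T)\in K[t_1,\dots,t_s]$. (2.3) Decide whether there is a linear dependency $v=\sum_i a_iv_i$ with $a_i\in K$ and $v_i\in PhiQB$. If yes, exit the loop. If no, add to $PPL$ those elements of $\{x_1T,\dots,x_nT\}$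 not already in $PPL$, append $T$ to $QB$, append $v$ to $PhiQB$, and continue the loop. Step 3. Output $g_{\mathrm{calc}}=T-\sum_i a_iT_i$, where $T_i\in QB$ is the power-product corresponding to $v_i\in PhiQB$, and $T$ and the $a_i$ are those for which the loop was exited. *)

theory Defs
  imports "HOL-Algebra.RingHom" "HOL-Library.Poly_Mapping"
begin

text \<open>
  A power-product is a finitely supported map from indices to exponents, written additively:
  \<open>0\<close> is the power-product 1 and \<open>+\<close> is multiplication of power-products.
  The indeterminates of the polynomial ring in \<open>n\<close> indeterminates have the indices \<open>0, \<dots>, n - 1\<close>.
\<close>

type_synonym pp = "nat \<Rightarrow>\<^sub>0 nat"
type_synonym 'k mpoly = "pp \<Rightarrow>\<^sub>0 'k"

definition power_products :: "nat \<Rightarrow> pp set" where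
  "power_products n = {T. Poly_Mapping.keys T \<subseteq> {..<n}}"

definition pp_var :: "nat \<Rightarrow> pp" where
  "pp_var i = Poly_Mapping.single i 1"

definition monom :: "pp \<Rightarrow> 'k::field mpoly" where
  "monom T = Poly_Mapping.single T 1"

definition const :: "'k \<Rightarrow> 'k::field mpoly" where
  "const c = Poly_Mapping.single 0 c"

definition mpoly_ring :: "nat \<Rightarrow> ('k::field mpoly) ring" where
  "mpoly_ring n =
     \<lparr>carrier = {p. Poly_Mapping.keys p \<subseteq> power_products n},
      monoid.mult = (*), one = 1, ring.zero = 0, add = (+)\<rparr>"

text \<open>The substitution homomorphism \<open>x\<^sub>i \<mapsto> f\<^sub>i\<close>.\<close>

definition phi :: "(nat \<Rightarrow> 'k::field mpoly) \<Rightarrow> 'k mpoly \<Rightarrow> 'k mpoly" where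
  "phi f p = (\<Sum>T\<in>Poly_Mapping.keys p. const (Poly_Mapping.lookup p T) *
                (\<Prod>i\<in>Poly_Mapping.keys T. f i ^ Poly_Mapping.lookup T i))"

definition Implicit :: "nat \<Rightarrow> nat \<Rightarrow> (nat \<Rightarrow> 'k::field mpoly) \<Rightarrow> 'k mpoly set" where
  "Implicit n s f = a_kernel (mpoly_ring n) (mpoly_ring s) (phi f)"

text \<open>Orderings are reflexive relations: \<open>(T, U) \<in> \<sigma>\<close> reads \<open>T \<le> U\<close>.\<close>

definition enumerative_on :: "'a set \<Rightarrow> ('a \<times> 'a) set \<Rightarrow> bool" where
  "enumerative_on A \<sigma> \<longleftrightarrow>
     linear_order_on A \<sigma> \<and> (\<forall>T\<in>A. finite {U\<in>A. (U, T) \<in> \<sigma> \<and> U \<noteq> T})"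

definition term_ordering :: "nat \<Rightarrow> (pp \<times> pp) set \<Rightarrow> bool" where
  "term_ordering n \<sigma> \<longleftrightarrow>
     linear_order_on (power_products n) \<sigma> \<and>
     (\<forall>T\<in>power_products n. (0, T) \<in> \<sigma>) \<and>
     (\<forall>T\<in>power_products n. \<forall>U\<in>power_products n. \<forall>V\<in>power_products n.
        (T, U) \<in> \<sigma> \<longrightarrow> (T + V, U + V) \<in> \<sigma>)"

definition enumerative_term_ordering :: "nat \<Rightarrow> (pp \<times> pp) set \<Rightarrow> bool" where
  "enumerative_term_ordering n \<sigma> \<longleftrightarrow>
     term_ordering n \<sigma> \<and> enumerative_on (power_products n) \<sigma>"

text \<open>
  The algorithm is a transition system. \<open>Running QB PhiQB PPL\<close> is the state at the start of an
  iteration of the main loop, \<open>Done g\<close> means that the algorithm has stopped with output \<open>g\<close>.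
  Any coefficients \<open>a\<close> that exhibit a linear dependency may be used for the output.
\<close>

datatype 'p config =
    Running "pp list" "'p list" "pp list"
  | Done 'p

definition is_min :: "(pp \<times> pp) set \<Rightarrow> pp list \<Rightarrow> pp \<Rightarrow> bool" where
  "is_min \<sigma> PPL T \<longleftrightarrow> T \<in> set PPL \<and> (\<forall>U\<in>set PPL. (T, U) \<in> \<sigma>)"

definition lin_comb :: "(nat \<Rightarrow> 'k::field) \<Rightarrow> 'k mpoly list \<Rightarrow> 'k mpoly" where
  "lin_comb a vs = (\<Sum>i<length vs. const (a i) * vs ! i)"

definition direct_init :: "'k::field mpoly config" where
  "direct_init = Running [] [] [0]"

inductive direct_step ::
  "nat \<Rightarrow> (nat \<Rightarrow> 'k::field mpoly) \<Rightarrow> (pp \<times> pp) set \<Rightarrow> 'k mpoly config \<Rightarrow> 'k mpoly config \<Rightarrow> bool"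
  for n f \<sigma>
where
  exit_loop:
    "\<lbrakk>is_min \<sigma> PPL T; v = phi f (monom T); v = lin_comb a PhiQB\<rbrakk> \<Longrightarrow>
     direct_step n f \<sigma> (Running QB PhiQB PPL) (Done (monom T - lin_comb a (map monom QB)))"
| continue_loop:
    "\<lbrakk>is_min \<sigma> PPL T; v = phi f (monom T); \<nexists>a. v = lin_comb a PhiQB;
      PPL' = remove1 T PPL;
      new = filter (\<lambda>U. U \<notin> set PPL') (map (\<lambda>i. pp_var i + T) [0..<n])\<rbrakk> \<Longrightarrow>
     direct_step n f \<sigma> (Running QB PhiQB PPL) (Running (QB @ [T]) (PhiQB @ [v]) (PPL' @ new))"

definition direct_outputs ::
  "nat \<Rightarrow> (nat \<Rightarrow> 'k::field mpoly) \<Rightarrow> (pp \<times> pp) set \<Rightarrow> 'k mpoly \<Rightarrow> bool"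
where
  "direct_outputs n f \<sigma> g \<longleftrightarrow> (direct_step n f \<sigma>)\<^sup>*\<^sup>* direct_init (Done g)"

text \<open>
  Termination excludes infinite runs and also runs that get stuck without output
  (which would happen if \<open>PPL\<close> became empty).
\<close>

definition direct_terminates ::
  "nat \<Rightarrow> (nat \<Rightarrow> 'k::field mpoly) \<Rightarrow> (pp \<times> pp) set \<Rightarrow> bool"
where
  "direct_terminates n f \<sigma> \<longleftrightarrow>
     (\<nexists>c. c 0 = direct_init \<and> (\<forall>k. direct_step n f \<sigma> (c k) (c (Suc k)))) \<and>
     (\<forall>c. (direct_step n f \<sigma>)\<^sup>*\<^sup>* direct_init c \<and> (\<nexists>c'. direct_step n f \<sigma> c c') \<longrightarrow>
        (\<exists>g. c = Done g))"

lemma pp_add: "T + U \<in> power_products n" if "T \<in> power_products n" "U \<in> power_products n"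
  using that Poly_Mapping.keys_add[of T U] by (auto simp: power_products_def)

lemma cring_mpoly_ring: "cring (mpoly_ring n :: 'k::field mpoly ring)"
proof (rule cringI)
  show "abelian_group (mpoly_ring n :: 'k mpoly ring)"
  proof (rule abelian_groupI)
    fix p assume p: "p \<in> carrier (mpoly_ring n :: 'k mpoly ring)"
    show "\<exists>q\<in>carrier (mpoly_ring n). q \<oplus>\<^bsub>mpoly_ring n\<^esub> p = \<zero>\<^bsub>mpoly_ring n\<^esub>"
      by (rule bexI[of _ "- p"])
         (use p in \<open>auto simp: mpoly_ring_def in_keys_iff\<close>)
  next
    fix p q :: "'k mpoly"
    assume "p \<in> carrier (mpoly_ring n)" "q \<in> carrier (mpoly_ring n)"
    then show "p \<oplus>\<^bsub>mpoly_ring n\<^esub> q \<in> carrier (mpoly_ring n)"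
      using Poly_Mapping.keys_add[of p q] by (auto simp: mpoly_ring_def)
  qed (auto simp: mpoly_ring_def algebra_simps)
  show "Group.comm_monoid (mpoly_ring n :: 'k mpoly ring)"
  proof (rule comm_monoidI)
    fix p q :: "'k mpoly"
    assume "p \<in> carrier (mpoly_ring n)" "q \<in> carrier (mpoly_ring n)"
    then show "p \<otimes>\<^bsub>mpoly_ring n\<^esub> q \<in> carrier (mpoly_ring n)"
      using Poly_Mapping.keys_mult[of p q] by (fastforce simp: mpoly_ring_def intro: pp_add)
  qed (auto simp: mpoly_ring_def power_products_def algebra_simps)
qed (auto simp: mpoly_ring_def algebra_simps)

lemma phi_const: "phi f (const c) = const c"
  by (simp add: phi_def const_def)

lemma phi_var: "phi f (monom (pp_var i)) = f i"
  by (simp add: phi_def monom_def pp_var_def const_def)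

lemma phi_alt:
  assumes "finite A" "Poly_Mapping.keys p \<subseteq> A"
  shows "phi f p = (\<Sum>T\<in>A. const (Poly_Mapping.lookup p T) *
           (\<Prod>i\<in>Poly_Mapping.keys T. f i ^ Poly_Mapping.lookup T i))"
  unfolding phi_def using assms
  by (intro sum.mono_neutral_left) (auto simp: const_def in_keys_iff)

lemma phi_add: "phi f (p + q) = phi f p + phi f q"
proof -
  let ?A = "Poly_Mapping.keys p \<union> Poly_Mapping.keys q"
  show ?thesis
    using Poly_Mapping.keys_add[of p q]
    by (simp add: phi_alt[of ?A] lookup_add const_def single_add distrib_right sum.distrib)
qed

lemma phi_single:
  "phi f (Poly_Mapping.single T c) =
     const c * (\<Prod>i\<in>Poly_Mapping.keys T. f i ^ Poly_Mapping.lookup T i)"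
  by (subst phi_alt[of "{T}"]) auto

lemma pp_prod_add:
  fixes f :: "nat \<Rightarrow> 'k::field mpoly"
  shows "(\<Prod>i\<in>Poly_Mapping.keys (T + U). f i ^ Poly_Mapping.lookup (T + U) i) =
         (\<Prod>i\<in>Poly_Mapping.keys T. f i ^ Poly_Mapping.lookup T i) *
         (\<Prod>i\<in>Poly_Mapping.keys U. f i ^ Poly_Mapping.lookup U i)"
proof -
  let ?A = "Poly_Mapping.keys T \<union> Poly_Mapping.keys U"
  have *: "(\<Prod>i\<in>Poly_Mapping.keys V. f i ^ Poly_Mapping.lookup V i) =
           (\<Prod>i\<in>?A. f i ^ Poly_Mapping.lookup V i)"
    if "Poly_Mapping.keys V \<subseteq> ?A" for V
    using that by (intro prod.mono_neutral_left) (auto simp: in_keys_iff)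
  show ?thesis
    unfolding *[OF Poly_Mapping.keys_add[of T U]] *[OF Un_upper1] *[OF Un_upper2]
    by (simp add: lookup_add power_add prod.distrib)
qed

lemma mpoly_sum_single:
  "p = (\<Sum>T\<in>Poly_Mapping.keys p. Poly_Mapping.single T (Poly_Mapping.lookup p T))"
  by (rule poly_mapping_eqI)
     (auto simp: lookup_sum lookup_single when_def in_keys_iff)

lemma phi_sum: "phi f (sum g A) = (\<Sum>x\<in>A. phi f (g x))"
  by (induction A rule: infinite_finite_induct) (auto simp: phi_add phi_def[of _ 0])

lemma phi_mult: "phi f (p * q) = phi f p * phi f q"
proof -
  have single: "phi f (Poly_Mapping.single T c * Poly_Mapping.single U d) =
        phi f (Poly_Mapping.single T c) * phi f (Poly_Mapping.single U d)" for T U c d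
    by (simp add: mult_single phi_single pp_prod_add)
       (simp add: const_def mult_single[of 0 c 0 d, simplified, symmetric] mult_ac)
  have "phi f (p * q) =
    phi f ((\<Sum>T\<in>Poly_Mapping.keys p. Poly_Mapping.single T (Poly_Mapping.lookup p T)) *
           (\<Sum>T\<in>Poly_Mapping.keys q. Poly_Mapping.single T (Poly_Mapping.lookup q T)))"
    by (simp flip: mpoly_sum_single)
  also have "\<dots> =
    phi f (\<Sum>T\<in>Poly_Mapping.keys p. Poly_Mapping.single T (Poly_Mapping.lookup p T)) *
    phi f (\<Sum>T\<in>Poly_Mapping.keys q. Poly_Mapping.single T (Poly_Mapping.lookup q T))"
    by (simp add: sum_product phi_sum single)
  finally show ?thesis by (simp flip: mpoly_sum_single)
qed

lemma phi_carrier: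
  assumes f: "\<And>i. i < n \<Longrightarrow> f i \<in> carrier (mpoly_ring s)"
    and p: "p \<in> carrier (mpoly_ring n)"
  shows "phi f p \<in> carrier (mpoly_ring s)"
proof -
  interpret cring "mpoly_ring s :: 'a mpoly ring" by (rule cring_mpoly_ring)
  let ?C = "carrier (mpoly_ring s :: 'a mpoly ring)"
  have zero: "0 \<in> ?C" and one: "1 \<in> ?C"
    and add: "\<And>p q. p \<in> ?C \<Longrightarrow> q \<in> ?C \<Longrightarrow> p + q \<in> ?C"
    and mult: "\<And>p q. p \<in> ?C \<Longrightarrow> q \<in> ?C \<Longrightarrow> p * q \<in> ?C"
    using zero_closed one_closed a_closed m_closed by (simp_all add: mpoly_ring_def)
  have const: "const c \<in> ?C" for c
    by (simp add: mpoly_ring_def const_def power_products_def)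
  have pow: "q ^ k \<in> ?C" if "q \<in> ?C" for q k
    by (induction k) (use that one mult in auto)
  have prod: "prod g A \<in> ?C" if "\<And>i. i \<in> A \<Longrightarrow> g i \<in> ?C" for g :: "nat \<Rightarrow> _" and A
    using that by (induction A rule: infinite_finite_induct) (use one mult in auto)
  have sum: "sum g A \<in> ?C" if "\<And>i. i \<in> A \<Longrightarrow> g i \<in> ?C" for g :: "pp \<Rightarrow> _" and A
    using that by (induction A rule: infinite_finite_induct) (use zero add in auto)
  have "Poly_Mapping.keys T \<subseteq> {..<n}" if "T \<in> Poly_Mapping.keys p" for T
    using p that by (auto simp: mpoly_ring_def power_products_def)
  then show ?thesis
    unfolding phi_def by (intro sum mult const prod pow f) auto
qed

lemma ring_hom_phi:
  assumes "\<And>i. i < n \<Longrightarrow> f i \<in> carrier (mpoly_ring s)"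
  shows "phi f \<in> ring_hom (mpoly_ring n) (mpoly_ring s)"
proof (rule ring_hom_memI)
  show "phi f \<one>\<^bsub>mpoly_ring n\<^esub> = \<one>\<^bsub>mpoly_ring s\<^esub>"
    using phi_const[of f 1] by (simp add: mpoly_ring_def const_def)
next
  fix p :: "'a mpoly" assume "p \<in> carrier (mpoly_ring n)"
  then show "phi f p \<in> carrier (mpoly_ring s)"
    using assms by (auto intro: phi_carrier)
qed (simp_all add: mpoly_ring_def phi_add phi_mult)

end

theory Submission
  imports Defs
begin

text \<open>
  The loop runs through the power-products in increasing order without omitting any: each
  power-product outside \<open>QB\<close> is a multiple of an element of \<open>PPL\<close>, and multiples are not
  smaller, so when \<open>T = min PPL\<close> is treated, every power-product below \<open>T\<close> is in \<open>QB\<close>. As long as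
  no linear dependency is found, the images of \<open>QB\<close> are linearly independent, which means that
  no non-zero polynomial of the kernel \<open>Implicit n s f\<close> is supported in \<open>QB\<close>. These facts form the
  invariant \<open>direct_inv\<close>.

  Termination: let \<open>p \<noteq> 0\<close> be in the kernel, with leading power-product \<open>L\<close>. Only finitely many
  power-products are \<open>\<preceq> L\<close>, so in a long enough run \<open>QB\<close>, being closed downwards, contains the
  whole support of \<open>p\<close>, against independence (\<open>no_infinite_run\<close>). If \<open>PPL\<close> were empty, \<open>QB\<close> would
  contain all power-products, which is impossible for the same reason (\<open>not_stuck\<close>).

  Correctness: at the exit, the output \<open>g\<close> lies in the kernel with leading power-product \<open>T\<close>, and by
  independence no non-zero kernel element has a smaller one (\<open>minimal_leading_exit\<close>). Let \<open>h\<close>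
  generate the kernel and write \<open>g = q h\<close>. Leading power-products multiply, so that of \<open>h\<close> is
  at most \<open>T\<close>; by minimality it is \<open>T\<close>, and then \<open>q\<close> has leading power-product \<open>1\<close>. Hence \<open>q\<close> is a
  non-zero constant, and \<open>g\<close> generates the same ideal as \<open>h\<close> (\<open>minimal_leading_generates\<close>).
\<close>

section \<open>Coefficients, supports and power-products\<close>

text \<open>
  The convolution sum for the coefficient at \<open>A + B\<close> collapses to one summand when the supports
  meet that exponent only at \<open>(A, B)\<close>. This applies to leading power-products and, with
  \<open>A = 0\<close>, to constant factors.
\<close>

lemma lookup_times_unique_split:
  fixes p q :: "'k::field mpoly"
  assumes "\<And>U V. U \<in> Poly_Mapping.keys p \<Longrightarrow> V \<in> Poly_Mapping.keys q \<Longrightarrow> U + V = A + B \<Longrightarrow>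
             U = A \<and> V = B"
  shows "Poly_Mapping.lookup (p * q) (A + B) = Poly_Mapping.lookup p A * Poly_Mapping.lookup q B"
proof -
  let ?p = "Poly_Mapping.lookup p" and ?q = "Poly_Mapping.lookup q"
  have "p * q = (\<Sum>U\<in>Poly_Mapping.keys p. Poly_Mapping.single U (?p U)) *
                (\<Sum>V\<in>Poly_Mapping.keys q. Poly_Mapping.single V (?q V))"
    by (simp flip: mpoly_sum_single)
  also have "\<dots> = (\<Sum>U\<in>Poly_Mapping.keys p. \<Sum>V\<in>Poly_Mapping.keys q.
                     Poly_Mapping.single (U + V) (?p U * ?q V))"
    by (simp add: sum_product mult_single)
  finally have "Poly_Mapping.lookup (p * q) (A + B) =
      (\<Sum>U\<in>Poly_Mapping.keys p. \<Sum>V\<in>Poly_Mapping.keys q. ?p U * ?q V when U + V = A + B)"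
    by (simp add: lookup_sum lookup_single)
  also have "\<dots> = (\<Sum>U\<in>Poly_Mapping.keys p. \<Sum>V\<in>Poly_Mapping.keys q.
                     if U = A then if V = B then ?p U * ?q V else 0 else 0)"
    using assms by (intro sum.cong refl) (auto simp: when_def)
  also have "\<dots> = (\<Sum>U\<in>Poly_Mapping.keys p. if U = A then ?p A * ?q B else 0)"
    by (intro sum.cong refl) (auto simp: in_keys_iff)
  also have "\<dots> = ?p A * ?q B"
    by (auto simp: in_keys_iff)
  finally show ?thesis .
qed

lemma lookup_const_times:
  fixes q :: "'k::field mpoly"
  shows "Poly_Mapping.lookup (const c * q) T = c * Poly_Mapping.lookup q T"
proof -
  have "Poly_Mapping.lookup (const c * q) (0 + T) =
        Poly_Mapping.lookup (const c) 0 * Poly_Mapping.lookup q T"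
    by (rule lookup_times_unique_split) (auto simp: const_def split: if_splits)
  then show ?thesis by (simp add: const_def)
qed

lemma lin_comb_monom_of_keys:
  fixes p :: "'k::field mpoly"
  assumes "distinct QB" "Poly_Mapping.keys p \<subseteq> set QB"
  shows "p = lin_comb (\<lambda>i. Poly_Mapping.lookup p (QB ! i)) (map monom QB)"
proof -
  have "p = (\<Sum>T\<in>Poly_Mapping.keys p. Poly_Mapping.single T (Poly_Mapping.lookup p T))"
    by (rule mpoly_sum_single)
  also have "\<dots> = (\<Sum>T\<in>set QB. Poly_Mapping.single T (Poly_Mapping.lookup p T))"
    by (rule sum.mono_neutral_left) (use assms in \<open>auto simp: in_keys_iff\<close>)
  also have "\<dots> = (\<Sum>i<length QB. Poly_Mapping.single (QB ! i) (Poly_Mapping.lookup p (QB ! i)))"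
    by (rule sum.reindex_bij_betw[symmetric]) (rule bij_betw_nth[OF assms(1)], auto)
  also have "\<dots> = lin_comb (\<lambda>i. Poly_Mapping.lookup p (QB ! i)) (map monom QB)"
    unfolding lin_comb_def by (auto simp: const_def monom_def mult_single intro!: sum.cong)
  finally show ?thesis .
qed

lemma keys_lin_comb_monom:
  "Poly_Mapping.keys (lin_comb a (map monom QB) :: 'k::field mpoly) \<subseteq> set QB"
proof
  fix T assume "T \<in> Poly_Mapping.keys (lin_comb a (map monom QB) :: 'k mpoly)"
  then have "(\<Sum>i<length QB. a i * Poly_Mapping.lookup (monom (QB ! i)) T) \<noteq> 0"
    by (simp add: in_keys_iff lin_comb_def lookup_sum lookup_const_times)
  then obtain i where "i < length QB" "a i * Poly_Mapping.lookup (monom (QB ! i)) T \<noteq> 0"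
    by (meson lessThan_iff sum.neutral)
  then show "T \<in> set QB"
    by (auto simp: monom_def lookup_single when_def split: if_splits)
qed

lemma phi_lin_comb_monom:
  "phi f (lin_comb a (map monom QB)) = lin_comb a (map (\<lambda>T. phi f (monom T)) QB)"
  by (simp add: lin_comb_def phi_sum phi_mult phi_const)

lemma phi_diff: "phi f (p - q) = phi f p - phi f q"
  by (metis add_diff_cancel_right' diff_add_cancel phi_add)

lemma zero_pp: "0 \<in> power_products n"
  by (simp add: power_products_def)

lemma pp_var_pp: "i < n \<Longrightarrow> pp_var i \<in> power_products n"
  by (simp add: power_products_def pp_var_def)

lemma pp_var_neq_zero: "pp_var i \<noteq> 0"
  by (metis lookup_single_eq lookup_zero pp_var_def zero_neq_one)

lemma pp_var_inj: "inj pp_var"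
  by (rule injI) (metis lookup_single_eq lookup_single_not_eq pp_var_def zero_neq_one)

lemma pp_split_var:
  assumes "V \<in> power_products n" "V \<noteq> 0"
  obtains i W where "i < n" "W \<in> power_products n" "V = pp_var i + W"
proof -
  from assms(2) obtain i where i: "i \<in> Poly_Mapping.keys V"
    by (metis all_not_in_conv keys_eq_empty)
  let ?W = "V - pp_var i"
  have "V = pp_var i + ?W"
    using i by (intro poly_mapping_eqI)
      (auto simp: lookup_add lookup_minus pp_var_def lookup_single when_def in_keys_iff)
  moreover have "Poly_Mapping.keys ?W \<subseteq> Poly_Mapping.keys V"
    by (auto simp: in_keys_iff lookup_minus)
  ultimately show ?thesis
    using that[of i ?W] i assms(1) by (auto simp: power_products_def)
qed

section \<open>Leading power-products for an enumerative term-ordering\<close>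

locale enumerative_term_order =
  fixes n :: nat and \<sigma> :: "(pp \<times> pp) set"
  assumes ordering: "enumerative_term_ordering n \<sigma>"
begin

abbreviation le :: "pp \<Rightarrow> pp \<Rightarrow> bool" (infix "\<preceq>" 50) where "T \<preceq> U \<equiv> (T, U) \<in> \<sigma>"

lemma linear: "linear_order_on (power_products n) \<sigma>"
  using ordering by (simp add: enumerative_term_ordering_def term_ordering_def)

lemma le_refl: "T \<in> power_products n \<Longrightarrow> T \<preceq> T"
  using linear by (auto simp: order_on_defs dest: refl_onD)

lemma le_trans: "T \<preceq> U \<Longrightarrow> U \<preceq> V \<Longrightarrow> T \<preceq> V"
  using linear by (auto simp: order_on_defs dest: transD)

lemma le_antisym: "T \<preceq> U \<Longrightarrow> U \<preceq> T \<Longrightarrow> T = U"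
  using linear by (auto simp: order_on_defs dest: antisymD)

lemma le_total: "T \<in> power_products n \<Longrightarrow> U \<in> power_products n \<Longrightarrow> T \<preceq> U \<or> U \<preceq> T"
  using linear le_refl[of T] unfolding order_on_defs total_on_def by (cases "T = U") blast+

lemma zero_le: "T \<in> power_products n \<Longrightarrow> 0 \<preceq> T"
  using ordering by (simp add: enumerative_term_ordering_def term_ordering_def)

lemma add_right_mono:
  "\<lbrakk>T \<preceq> U; T \<in> power_products n; U \<in> power_products n; V \<in> power_products n\<rbrakk> \<Longrightarrow> T + V \<preceq> U + V"
  using ordering by (simp add: enumerative_term_ordering_def term_ordering_def)

lemma finite_below: "T \<in> power_products n \<Longrightarrow> finite {U \<in> power_products n. U \<preceq> T}"
proof -
  assume T: "T \<in> power_products n"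
  then have "finite (insert T {U \<in> power_products n. U \<preceq> T \<and> U \<noteq> T})"
    using ordering by (simp add: enumerative_term_ordering_def enumerative_on_def)
  then show ?thesis by (rule rev_finite_subset) auto
qed

lemma le_add_left:
  "T \<in> power_products n \<Longrightarrow> V \<in> power_products n \<Longrightarrow> T \<preceq> V + T"
  using add_right_mono[of 0 V T] zero_le[of V] by (simp add: zero_pp)

text \<open>
  The reason why leading terms cannot cancel in a product: compatibility with multiplication gives
  \<open>U + V \<preceq> A + V \<preceq> A + B\<close>, and if the ends agree, cancellation makes both steps equalities.
\<close>

lemma add_eq_addD:
  assumes "U \<preceq> A" "V \<preceq> B" "U + V = A + B"
    and "U \<in> power_products n" "V \<in> power_products n"
        "A \<in> power_products n" "B \<in> power_products n"
  shows "U = A \<and> V = B"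
proof -
  have "A + V \<preceq> A + B"
    using add_right_mono[of V B A] assms by (simp add: add.commute)
  moreover have "A + B \<preceq> A + V"
    using add_right_mono[of U A V] assms by simp
  ultimately have "A + V = A + B" by (rule le_antisym)
  then have "V = B" by simp
  with assms(3) show ?thesis by simp
qed

lemma finite_has_le:
  assumes "finite S" "S \<noteq> {}" "S \<subseteq> power_products n"
  shows "\<exists>T\<in>S. \<forall>U\<in>S. T \<preceq> U" "\<exists>T\<in>S. \<forall>U\<in>S. U \<preceq> T"
  using assms
proof (induction S rule: finite_ne_induct)
  case (singleton x)
  { case 1 then show ?case using le_refl by simp }
  { case 2 then show ?case using le_refl by simp }
next
  case (insert x S)
  { case 1
    then obtain T where "T \<in> S" "\<forall>U\<in>S. T \<preceq> U" using insert.IH(1) by auto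
    moreover have "x \<preceq> T \<or> T \<preceq> x" "x \<preceq> x"
      using 1 \<open>T \<in> S\<close> le_total[of x T] by (auto intro: le_refl)
    ultimately show ?case using le_trans by blast }
  { case 2
    then obtain T where "T \<in> S" "\<forall>U\<in>S. U \<preceq> T" using insert.IH(2) by auto
    moreover have "x \<preceq> T \<or> T \<preceq> x" "x \<preceq> x"
      using 2 \<open>T \<in> S\<close> le_total[of x T] by (auto intro: le_refl)
    ultimately show ?case using le_trans by blast }
qed

lemma obtain_leading:
  fixes p :: "'k::field mpoly"
  assumes "p \<in> carrier (mpoly_ring n)" "p \<noteq> 0"
  obtains L where "L \<in> Poly_Mapping.keys p" "L \<in> power_products n"
    "\<And>U. U \<in> Poly_Mapping.keys p \<Longrightarrow> U \<in> power_products n \<and> U \<preceq> L"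
  using finite_has_le(2)[of "Poly_Mapping.keys p"] assms that
  by (auto simp: mpoly_ring_def subset_iff)

lemma leading_times:
  fixes p q :: "'k::field mpoly"
  assumes "p \<in> carrier (mpoly_ring n)" "q \<in> carrier (mpoly_ring n)"
    and "A \<in> Poly_Mapping.keys p" "\<And>U. U \<in> Poly_Mapping.keys p \<Longrightarrow> U \<preceq> A"
    and "B \<in> Poly_Mapping.keys q" "\<And>V. V \<in> Poly_Mapping.keys q \<Longrightarrow> V \<preceq> B"
  shows "A + B \<in> Poly_Mapping.keys (p * q)"
proof -
  have "Poly_Mapping.lookup (p * q) (A + B) = Poly_Mapping.lookup p A * Poly_Mapping.lookup q B"
    by (rule lookup_times_unique_split, rule add_eq_addD) (use assms in \<open>auto simp: mpoly_ring_def\<close>)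
  then show ?thesis using assms(3,5) by (simp add: in_keys_iff)
qed

end

section \<open>The loop invariant\<close>

locale direct_algorithm = enumerative_term_order n \<sigma> for n \<sigma> +
  fixes s :: nat and f :: "nat \<Rightarrow> 'k::field mpoly"
begin

lemma Implicit_iff: "p \<in> Implicit n s f \<longleftrightarrow> p \<in> carrier (mpoly_ring n) \<and> phi f p = 0"
  by (simp add: Implicit_def a_kernel_def' mpoly_ring_def)

text \<open>
  The last conjunct is the linear independence of \<open>PhiQB\<close>, phrased in terms of polynomials supported
  in \<open>QB\<close>. The last but one is the reason why no power-product is left out.
\<close>

definition direct_inv :: "pp list \<Rightarrow> 'k mpoly list \<Rightarrow> pp list \<Rightarrow> bool" where
  "direct_inv QB PhiQB PPL \<longleftrightarrow>
     PhiQB = map (\<lambda>T. phi f (monom T)) QB \<and> distinct QB \<and> distinct PPL \<and>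
     set QB \<subseteq> power_products n \<and> set PPL \<subseteq> power_products n \<and>
     (\<forall>Q\<in>set QB. \<forall>P\<in>set PPL. Q \<preceq> P \<and> Q \<noteq> P) \<and>
     (\<forall>U\<in>power_products n. U \<notin> set QB \<longrightarrow> (\<exists>P\<in>set PPL. \<exists>V\<in>power_products n. U = V + P)) \<and>
     (\<forall>p\<in>Implicit n s f. Poly_Mapping.keys p \<subseteq> set QB \<longrightarrow> p = 0)"

lemma direct_inv_init: "direct_inv [] [] [0]"
  by (auto simp: direct_inv_def zero_pp)

text \<open>
  If \<open>U \<preceq> Q\<close> were missing from \<open>QB\<close>, it would be a multiple of some \<open>P\<close> in \<open>PPL\<close>, and
  \<open>P \<preceq> U \<preceq> Q\<close> contradicts that \<open>PPL\<close> lies strictly above \<open>QB\<close>.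
\<close>

lemma direct_inv_below:
  assumes "direct_inv QB PhiQB PPL" "U \<in> power_products n"
    and "U \<preceq> Q" "Q \<in> set QB"
  shows "U \<in> set QB"
proof (rule ccontr)
  assume "U \<notin> set QB"
  with assms obtain P V where P: "P \<in> set PPL" "V \<in> power_products n" "U = V + P"
    unfolding direct_inv_def by blast
  with assms(1) have "P \<preceq> U" by (auto simp: direct_inv_def intro!: le_add_left)
  then have "P \<preceq> Q" using assms(3) by (rule le_trans)
  moreover have "Q \<preceq> P" "Q \<noteq> P" using assms(1,4) P(1) by (auto simp: direct_inv_def)
  ultimately show False using le_antisym by blast
qed

lemma direct_inv_below_min:
  assumes "direct_inv QB PhiQB PPL" "is_min \<sigma> PPL T" "U \<in> power_products n"
    and "U \<preceq> T" "U \<noteq> T"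
  shows "U \<in> set QB"
proof (rule ccontr)
  assume "U \<notin> set QB"
  with assms obtain P V where P: "P \<in> set PPL" "V \<in> power_products n" "U = V + P"
    unfolding direct_inv_def by blast
  with assms(1) have "P \<preceq> U" by (auto simp: direct_inv_def intro!: le_add_left)
  moreover have "T \<preceq> P" using assms(2) P(1) by (simp add: is_min_def)
  ultimately have "T \<preceq> U" using le_trans by blast
  with assms(4,5) show False using le_antisym by blast
qed

text \<open>
  A kernel element that involves \<open>T\<close> can be solved for \<open>T\<close>, which expresses \<open>phi f (monom T)\<close> as a
  linear combination of \<open>PhiQB\<close>.
\<close>

lemma independent_snoc:
  assumes inv: "direct_inv QB PhiQB PPL" and T: "T \<in> power_products n"
    and indep: "\<nexists>a. phi f (monom T) = lin_comb a PhiQB"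
    and p: "p \<in> Implicit n s f" "Poly_Mapping.keys p \<subseteq> insert T (set QB)"
  shows "p = 0"
proof -
  let ?c = "Poly_Mapping.lookup p T"
  have "?c = 0"
  proof (rule ccontr)
    assume c: "?c \<noteq> 0"
    \<comment> \<open>The coefficients of \<open>p\<close> are scaled so that \<open>T\<close> cancels; the image is still that of \<open>T\<close>.\<close>
    let ?q = "monom T - const (1 / ?c) * p"
    have "Poly_Mapping.keys ?q \<subseteq> set QB"
    proof
      fix U assume "U \<in> Poly_Mapping.keys ?q"
      then have "Poly_Mapping.lookup (monom T) U \<noteq> Poly_Mapping.lookup p U / ?c"
        by (simp add: in_keys_iff lookup_minus lookup_const_times)
      then have "U \<noteq> T" "U \<in> Poly_Mapping.keys p"
        using c by (auto simp: monom_def lookup_single when_def in_keys_iff split: if_splits)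
      with p(2) show "U \<in> set QB" by auto
    qed
    then have "?q = lin_comb (\<lambda>i. Poly_Mapping.lookup ?q (QB ! i)) (map monom QB)"
      using inv by (intro lin_comb_monom_of_keys) (auto simp: direct_inv_def)
    then have "phi f ?q = lin_comb (\<lambda>i. Poly_Mapping.lookup ?q (QB ! i)) PhiQB"
      using inv by (metis phi_lin_comb_monom direct_inv_def)
    moreover have "phi f ?q = phi f (monom T)"
      using p(1) by (simp add: Implicit_iff phi_diff phi_mult)
    ultimately show False using indep by metis
  qed
  then have "Poly_Mapping.keys p \<subseteq> set QB"
    using p(2) by (auto simp: in_keys_iff)
  with inv p(1) show ?thesis by (auto simp: direct_inv_def)
qed

text \<open>
  Only the covering of all power-products needs an idea: proper multiples of the removed \<open>T\<close> are
  multiples of some \<open>x\<^sub>i T\<close>, which is now in \<open>PPL\<close>. The new elements lie strictly above \<open>T\<close>, so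
  \<open>PPL\<close> stays above \<open>QB\<close> and no power-product is treated twice.
\<close>

lemma direct_inv_step:
  assumes inv: "direct_inv QB PhiQB PPL" and min: "is_min \<sigma> PPL T"
    and indep: "\<nexists>a. phi f (monom T) = lin_comb a PhiQB"
    and new: "new = filter (\<lambda>U. U \<notin> set (remove1 T PPL)) (map (\<lambda>i. pp_var i + T) [0..<n])"
  shows "direct_inv (QB @ [T]) (PhiQB @ [phi f (monom T)]) (remove1 T PPL @ new)"
proof -
  have T: "T \<in> set PPL" "T \<in> power_products n" "T \<notin> set QB"
    using inv min by (auto simp: direct_inv_def is_min_def)
  have rem: "set (remove1 T PPL) = set PPL - {T}"
    using inv by (simp add: direct_inv_def)
  have PPL': "set (remove1 T PPL @ new) = (set PPL - {T}) \<union> (\<lambda>i. pp_var i + T) ` {..<n}"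
    by (auto simp: new rem)
  have var: "T \<preceq> pp_var i + T" "T \<noteq> pp_var i + T" "pp_var i + T \<in> power_products n"
    if "i < n" for i
    using that T(2) pp_var_neq_zero[of i] by (auto intro: le_add_left pp_var_pp pp_add)
  have dist: "distinct (remove1 T PPL @ new)"
  proof -
    have "inj_on (\<lambda>i. pp_var i + T) A" for A
      using pp_var_inj by (auto simp: inj_on_def)
    then have "distinct new" by (simp add: new distinct_map distinct_filter)
    then show ?thesis using inv by (auto simp: direct_inv_def new)
  qed
  have gt: "Q \<preceq> P \<and> Q \<noteq> P" if "Q \<in> set (QB @ [T])" "P \<in> set (remove1 T PPL @ new)" for Q P
  proof -
    have TP: "T \<preceq> P \<and> T \<noteq> P"
      using that(2)[unfolded PPL'] min var by (auto simp: is_min_def)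
    show ?thesis
    proof (cases "Q = T")
      case False
      with that(1) inv T(1) have "Q \<preceq> T" "Q \<noteq> T" by (auto simp: direct_inv_def)
      with TP show ?thesis using le_trans le_antisym by blast
    qed (use TP in simp)
  qed
  have cover: "\<exists>P\<in>set (remove1 T PPL @ new). \<exists>V\<in>power_products n. U = V + P"
    if U: "U \<in> power_products n" "U \<notin> set (QB @ [T])" for U
  proof -
    from U inv obtain P V where P: "P \<in> set PPL" "V \<in> power_products n" "U = V + P"
      unfolding direct_inv_def by auto
    show ?thesis
    proof (cases "P = T")
      case True
      with U(2) P(3) have "V \<noteq> 0" by auto
      with P(2) obtain i W where "i < n" "W \<in> power_products n" "V = pp_var i + W"
        by (rule pp_split_var)
      moreover from this have "pp_var i + T \<in> set (remove1 T PPL @ new)"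
        unfolding PPL' by blast
      moreover have "U = W + (pp_var i + T)"
        using P(3) True \<open>V = pp_var i + W\<close> by (simp add: ac_simps)
      ultimately show ?thesis by blast
    next
      case False
      with P show ?thesis unfolding PPL' by blast
    qed
  qed
  have "\<forall>p\<in>Implicit n s f. Poly_Mapping.keys p \<subseteq> set (QB @ [T]) \<longrightarrow> p = 0"
    using independent_snoc[OF inv T(2) indep] by simp
  moreover have "set (remove1 T PPL @ new) \<subseteq> power_products n"
    unfolding PPL' using inv var by (auto simp: direct_inv_def)
  moreover have "distinct (QB @ [T])" "set (QB @ [T]) \<subseteq> power_products n"
       "PhiQB @ [phi f (monom T)] = map (\<lambda>T. phi f (monom T)) (QB @ [T])"
    using inv T by (auto simp: direct_inv_def)
  ultimately show ?thesis
    unfolding direct_inv_def using gt cover dist by (intro conjI ballI impI) simp_all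
qed

section \<open>Outputs have minimal leading power-product in the kernel\<close>

text \<open>
  The witness \<open>T\<close> is the leading power-product of \<open>g\<close>; that \<open>p\<close> has some \<open>U\<close> with \<open>T \<preceq> U\<close> in its
  support says that the leading power-product of \<open>p\<close> is at least \<open>T\<close>.
\<close>

definition minimal_leading :: "'k mpoly \<Rightarrow> bool" where
  "minimal_leading g \<longleftrightarrow> g \<in> Implicit n s f \<and>
     (\<exists>T\<in>Poly_Mapping.keys g. (\<forall>U\<in>Poly_Mapping.keys g. U \<preceq> T) \<and>
        (\<forall>p\<in>Implicit n s f. p \<noteq> 0 \<longrightarrow> (\<exists>U\<in>Poly_Mapping.keys p. T \<preceq> U)))"

text \<open>
  A kernel element all of whose power-products were below \<open>T\<close> would be supported in \<open>QB\<close>, hence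
  zero by independence.
\<close>

lemma minimal_leading_exit:
  assumes inv: "direct_inv QB PhiQB PPL" and min: "is_min \<sigma> PPL T"
    and dep: "phi f (monom T) = lin_comb a PhiQB"
  shows "minimal_leading (monom T - lin_comb a (map monom QB))" (is "minimal_leading ?g")
proof -
  have T: "T \<in> set PPL" "T \<in> power_products n" "T \<notin> set QB"
    using inv min by (auto simp: direct_inv_def is_min_def)
  let ?r = "lin_comb a (map monom QB) :: 'k mpoly"
  have kr: "Poly_Mapping.keys ?r \<subseteq> set QB" by (rule keys_lin_comb_monom)
  have kg: "Poly_Mapping.keys ?g \<subseteq> insert T (set QB)"
    using kr keys_diff[of "monom T" ?r] by (auto simp: monom_def split: if_splits)
  have "T \<notin> Poly_Mapping.keys ?r" using kr T(3) by auto
  then have "Poly_Mapping.lookup ?g T = 1"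
    by (simp add: lookup_minus monom_def in_keys_iff)
  then have Tg: "T \<in> Poly_Mapping.keys ?g" by (simp add: in_keys_iff)
  have "phi f ?r = lin_comb a PhiQB"
    using inv by (simp add: direct_inv_def phi_lin_comb_monom)
  then have "?g \<in> Implicit n s f"
    using kg T(2) inv dep by (auto simp: Implicit_iff phi_diff mpoly_ring_def direct_inv_def)
  moreover have "U \<preceq> T" if "U \<in> Poly_Mapping.keys ?g" for U
    using that kg T inv le_refl by (auto simp: direct_inv_def)
  moreover have "\<exists>U\<in>Poly_Mapping.keys p. T \<preceq> U" if p: "p \<in> Implicit n s f" "p \<noteq> 0" for p
  proof -
    from p inv obtain U where U: "U \<in> Poly_Mapping.keys p" "U \<notin> set QB"
      unfolding direct_inv_def by blast
    moreover from U p have "U \<in> power_products n"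
      by (auto simp: Implicit_iff mpoly_ring_def)
    ultimately show ?thesis
      using direct_inv_below_min[OF inv min, of U] le_total[of U T] T(2) le_refl[of T] by metis
  qed
  ultimately show ?thesis unfolding minimal_leading_def using Tg by blast
qed

fun config_inv :: "'k mpoly config \<Rightarrow> bool" where
  "config_inv (Running QB PhiQB PPL) = direct_inv QB PhiQB PPL"
| "config_inv (Done g) = minimal_leading g"

lemma config_inv_step: "direct_step n f \<sigma> c c' \<Longrightarrow> config_inv c \<Longrightarrow> config_inv c'"
  by (induction rule: direct_step.induct) (auto intro: minimal_leading_exit direct_inv_step)

lemma config_inv_reachable: "(direct_step n f \<sigma>)\<^sup>*\<^sup>* direct_init c \<Longrightarrow> config_inv c"
  by (induction rule: rtranclp_induct)
     (auto simp: direct_init_def direct_inv_init intro: config_inv_step)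

section \<open>Termination\<close>

text \<open>
  The length of \<open>QB\<close> counts the iterations, so it eventually exceeds the number of power-products
  not above the leading one of \<open>p\<close>.
\<close>

lemma no_infinite_run:
  assumes p: "p \<in> Implicit n s f" "p \<noteq> 0"
    and c: "c 0 = direct_init" "\<And>k. direct_step n f \<sigma> (c k) (c (Suc k))"
  shows False
proof -
  have "\<exists>QB PhiQB PPL. c k = Running QB PhiQB PPL \<and> direct_inv QB PhiQB PPL \<and> length QB = k" for k
  proof (induction k)
    case 0
    show ?case by (simp add: c direct_init_def direct_inv_init)
  next
    case (Suc k)
    then obtain QB PhiQB PPL where k: "c k = Running QB PhiQB PPL"
      "direct_inv QB PhiQB PPL" "length QB = k" by blast
    from c(2)[of "Suc k"] obtain QB' PhiQB' PPL' where k': "c (Suc k) = Running QB' PhiQB' PPL'"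
      by (auto elim: direct_step.cases)
    have "direct_inv QB' PhiQB' PPL'"
      using config_inv_step[OF c(2)[of k]] k k' by simp
    moreover have "length QB' = Suc k"
      using c(2)[of k] unfolding k(1) k' by (auto elim!: direct_step.cases simp: k(3))
    ultimately show ?case using k' by blast
  qed
  note run = this
  from p obtain L where L: "L \<in> Poly_Mapping.keys p" "L \<in> power_products n"
    "\<And>U. U \<in> Poly_Mapping.keys p \<Longrightarrow> U \<in> power_products n \<and> U \<preceq> L"
    using obtain_leading[of p] unfolding Implicit_iff by metis
  let ?B = "{U \<in> power_products n. U \<preceq> L}"
  obtain QB PhiQB PPL where QB: "direct_inv QB PhiQB PPL" "length QB = Suc (card ?B)"
    using run by blast
  then have "card (set QB) > card ?B" by (simp add: direct_inv_def distinct_card)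
  then have "\<not> set QB \<subseteq> ?B"
    using finite_below[OF L(2)] card_mono[of ?B "set QB"] by (auto simp: not_le)
  then obtain Q where Q: "Q \<in> set QB" "Q \<in> power_products n" "L \<preceq> Q"
    using QB(1) L(2) le_total[of L] by (auto simp: direct_inv_def)
  have "Poly_Mapping.keys p \<subseteq> set QB"
    using L(3) Q direct_inv_below[OF QB(1) _ _ Q(1)] le_trans by blast
  with QB(1) p show False by (auto simp: direct_inv_def)
qed

lemma not_stuck:
  assumes p: "p \<in> Implicit n s f" "p \<noteq> 0"
    and inv: "direct_inv QB PhiQB PPL"
  shows "\<exists>c'. direct_step n f \<sigma> (Running QB PhiQB PPL) c'"
proof -
  have "PPL \<noteq> []"
  proof
    assume "PPL = []"
    with inv have "power_products n \<subseteq> set QB" by (auto simp: direct_inv_def)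
    with p(1) have "Poly_Mapping.keys p \<subseteq> set QB" by (auto simp: Implicit_iff mpoly_ring_def)
    with inv p show False by (auto simp: direct_inv_def)
  qed
  then obtain T where "is_min \<sigma> PPL T"
    using finite_has_le(1)[of "set PPL"] inv by (auto simp: direct_inv_def is_min_def)
  then show ?thesis
    using exit_loop[OF _ refl] continue_loop[OF _ refl _ refl refl] by metis
qed

section \<open>Minimal elements generate a principal kernel\<close>

text \<open>
  Minimality of \<open>g\<close> forces the cofactor \<open>q\<close> in \<open>g = q * h\<close> to have leading power-product \<open>0\<close>; since
  \<open>0\<close> is the least power-product, \<open>q\<close> is a constant.
\<close>

lemma minimal_leading_generates:
  assumes principal: "principalideal (Implicit n s f) (mpoly_ring n)" and g: "minimal_leading g"
  shows "Implicit n s f = Idl\<^bsub>mpoly_ring n\<^esub> {g}"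
proof -
  let ?R = "mpoly_ring n :: 'k mpoly ring"
  interpret R: cring ?R by (rule cring_mpoly_ring)
  from g obtain T where gI: "g \<in> Implicit n s f" and T: "T \<in> Poly_Mapping.keys g"
    "\<And>U. U \<in> Poly_Mapping.keys g \<Longrightarrow> U \<preceq> T"
    "\<And>p. p \<in> Implicit n s f \<Longrightarrow> p \<noteq> 0 \<Longrightarrow> \<exists>U\<in>Poly_Mapping.keys p. T \<preceq> U"
    unfolding minimal_leading_def by blast
  have gR: "g \<in> carrier ?R" using gI by (simp add: Implicit_iff)
  obtain h where h: "h \<in> carrier ?R" "Implicit n s f = Idl\<^bsub>?R\<^esub> {h}"
    using principalideal.generate[OF principal] by blast
  have PIh: "Implicit n s f = PIdl\<^bsub>?R\<^esub> h" using h R.cgenideal_eq_genideal by simp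
  then have hI: "h \<in> Implicit n s f" using R.cgenideal_self[OF h(1)] by simp
  from gI PIh obtain q where q: "q \<in> carrier ?R" "g = q * h"
    by (auto simp: cgenideal_def mpoly_ring_def)
  have "q \<noteq> 0" "h \<noteq> 0" using q(2) T(1) by auto
  from obtain_leading[OF q(1) this(1)] obtain A where
    A: "A \<in> Poly_Mapping.keys q" "A \<in> power_products n"
       "\<And>U. U \<in> Poly_Mapping.keys q \<Longrightarrow> U \<in> power_products n \<and> U \<preceq> A" by blast
  from obtain_leading[OF h(1) \<open>h \<noteq> 0\<close>] obtain B where
    B: "B \<in> Poly_Mapping.keys h" "B \<in> power_products n"
       "\<And>U. U \<in> Poly_Mapping.keys h \<Longrightarrow> U \<in> power_products n \<and> U \<preceq> B" by blast
  have "A + B \<in> Poly_Mapping.keys g"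
    unfolding q(2) by (rule leading_times[OF q(1) h(1)]) (use A B in auto)
  then have "A + B \<preceq> T" by (rule T(2))
  moreover have "T \<preceq> B" using T(3)[OF hI \<open>h \<noteq> 0\<close>] B(3) le_trans by blast
  ultimately have "A + B \<preceq> B" by (rule le_trans)
  moreover have "B \<preceq> A + B" using A(2) B(2) by (rule le_add_left[rotated])
  ultimately have "A + B = B" by (rule le_antisym)
  then have "A = 0" by simp
  with A(3) have "Poly_Mapping.keys q \<subseteq> {0}"
    using zero_le le_antisym by blast
  define c where "c = Poly_Mapping.lookup q 0"
  have qc: "q = const c"
    using \<open>Poly_Mapping.keys q \<subseteq> {0}\<close>
    by (intro poly_mapping_eqI)
       (auto simp: c_def const_def lookup_single when_def in_keys_iff subset_iff)
  have "c \<noteq> 0" using \<open>q \<noteq> 0\<close> by (auto simp: qc const_def)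
  have "const (1 / c) * g = const (1 / c) * const c * h"
    by (simp add: q(2) qc mult.assoc)
  also have "const (1 / c) * const c = (1 :: 'k mpoly)"
    using \<open>c \<noteq> 0\<close> by (simp add: const_def mult_single)
  finally have hg: "h = const (1 / c) * g" by simp
  have "const (1 / c) \<in> carrier ?R"
    by (simp add: mpoly_ring_def const_def zero_pp)
  then have "h \<in> PIdl\<^bsub>?R\<^esub> g" using hg by (auto simp: cgenideal_def mpoly_ring_def)
  then have "h \<in> Idl\<^bsub>?R\<^esub> {g}" using R.cgenideal_eq_genideal[OF gR] by simp
  then have "Idl\<^bsub>?R\<^esub> {h} \<subseteq> Idl\<^bsub>?R\<^esub> {g}"
    using R.genideal_minimal[OF R.genideal_ideal] gR by simp
  moreover have "Idl\<^bsub>?R\<^esub> {g} \<subseteq> Implicit n s f"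
    using R.genideal_minimal[OF principalideal.axioms(1)[OF principal]] gI by simp
  ultimately show ?thesis using h(2) by simp
qed

end

theorem mainTheorem4:
  fixes n s :: nat
    and f :: "nat \<Rightarrow> 'k::field mpoly"
    and \<sigma> :: "(pp \<times> pp) set"
  assumes "\<And>i. i < n \<Longrightarrow> f i \<in> carrier (mpoly_ring s)"
    and "principalideal (Implicit n s f) (mpoly_ring n)"
    and "Implicit n s f \<noteq> {\<zero>\<^bsub>mpoly_ring n\<^esub>}"
    and "enumerative_term_ordering n \<sigma>"
  shows "direct_terminates n f \<sigma> \<and>
         (\<forall>g. direct_outputs n f \<sigma> g \<longrightarrow>
            g \<in> carrier (mpoly_ring n) \<and> Implicit n s f = Idl\<^bsub>mpoly_ring n\<^esub> {g})"
proof -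
  interpret direct_algorithm n \<sigma> s f
    using assms(4) by unfold_locales
  have "0 \<in> Implicit n s f"
    by (simp add: Implicit_iff mpoly_ring_def phi_def)
  then obtain p where p: "p \<in> Implicit n s f" "p \<noteq> 0"
    using assms(3) by (auto simp: mpoly_ring_def)
  have "direct_terminates n f \<sigma>"
    unfolding direct_terminates_def
  proof (intro conjI allI impI)
    show "\<nexists>c. c 0 = direct_init \<and> (\<forall>k. direct_step n f \<sigma> (c k) (c (Suc k)))"
      using no_infinite_run[OF p] by blast
  next
    fix c assume c: "(direct_step n f \<sigma>)\<^sup>*\<^sup>* direct_init c \<and> (\<nexists>c'. direct_step n f \<sigma> c c')"
    then show "\<exists>g. c = Done g"
      using config_inv_reachable[of c] not_stuck[OF p] by (cases c) auto
  qed
  moreover have "g \<in> carrier (mpoly_ring n) \<and> Implicit n s f = Idl\<^bsub>mpoly_ring n\<^esub> {g}"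
    if "direct_outputs n f \<sigma> g" for g
  proof -
    have "minimal_leading g" using that config_inv_reachable[of "Done g"] by (simp add: direct_outputs_def)
    then show ?thesis using minimal_leading_generates[OF assms(2)] unfolding minimal_leading_def Implicit_iff by blast
  qed
  ultimately show ?thesis by blast
qed

end
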